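(* Let $\mathbf{a}=(a_1,\dots,a_n),\mathbf{b}=(b_1,\dots,b_n)\in\mathbb{N}^n$, assume $(\mathbf{a},\mathbf{b})$ is non-degenerate, and let $\Phi=\Phi_{\mathbf{a},\mathbf{b}}$. Let $$C=\{\boldsymbol\gamma+(0,0,1,\dots,1) : \boldsymbol\gamma\in\mathrm{FUND}_\Phi\setminus(\{\boldsymbol\alpha_1,\dots,\boldsymbol\alpha_n\}\cup\{\boldsymbol\beta(1,0),\boldsymbol\beta(0,1)\})\}\subset\mathbb{N}^{3n+2}.$$ Then the set of minimal positive elements $\boldsymbol\beta\in E_\Phi$ is equal to $C$.
   Context: $\mathbb{N}$ denotes the nonnegative integers. Put $a_0=1$, $b_0=0$, $a_{n+1}=0$, $b_{n+1}=1$. $(\mathbf{a},\mathbf{b})$ is non-degenerate if $a_i/b_i>a_{i+1}/b_{i+1}$ for all $i=0,\dots,n$, with the convention $a_i/b_i=\infty$ if $b_i=0$. The semigroup $E_\Phi$: $\Phi_{\mathbf{a},\mathbf{b}}$ is the $2n\times(3n+2)$ integer matrix such that $$E_\Phi=\{\boldsymbol\beta\in\mathbb{N}^{3n+2} : \Phi\boldsymbol\beta=0\}=\{(r,s,h_1,k_1,m_1,\dots,h_n,k_n,m_n)\in\mathbb{N}^{3n+2} : a_ir+h_i=m_i=b_is+k_i,\ i=1,\dots,n\}.$$ For $j=1,\dots,n$ let $\pi_j(r,s,h_1,k_1,m_1,\dots,h_n,k_n,m_n)=(r,s,h_j,k_j,m_j)$. A nonzero $\boldsymbol\beta\in E_\Phi$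 is fundamental if $\boldsymbol\beta=\boldsymbol\gamma+\boldsymbol\delta$ with $\boldsymbol\gamma,\boldsymbol\delta\in E_\Phi$ implies $\boldsymbol\gamma=\boldsymbol\beta$ or $\boldsymbol\delta=\boldsymbol\beta$; $\mathrm{FUND}_\Phi$ is the set of fundamental elements. $\boldsymbol\alpha_i\in E_\Phi$ is the vector with $\pi_i(\boldsymbol\alpha_i)=(0,0,1,1,1)$ and $\pi_j(\boldsymbol\alpha_i)=(0,0,0,0,0)$ for $j\ne i$. For $(r,s)\in\mathbb{N}^2$, $\boldsymbol\beta(r,s)\in E_\Phi$ is the vector with $\pi_j(\boldsymbol\beta(r,s))=(r,s,\max(a_jr,b_js)-a_jr,\max(a_jr,b_js)-b_js,\max(a_jr,b_js))$ for all $j$. $\boldsymbol\beta\in E_\Phi$ is positive ($\boldsymbol\beta>0$) if each coordinate is positive. A positive $\boldsymbol\beta\in E_\Phi$ is minimal if there is no positive $\boldsymbol\gamma\in E_\Phi$ with $\boldsymbol\gamma\neq\boldsymbol\beta$ and $\boldsymbol\beta-\boldsymbol\gamma\ge0$ coordinatewise. *)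

theory Defs
  imports "Jordan_Normal_Form.Matrix" "HOL-Library.Extended_Real"
begin

section \<open>Nonnegative integer solutions of a homogeneous linear system\<close>

definition nat_kernel :: "int mat \<Rightarrow> nat vec set" where
  "nat_kernel \<Phi> = {\<beta> \<in> carrier_vec (dim_col \<Phi>). \<Phi> *\<^sub>v map_vec int \<beta> = 0\<^sub>v (dim_row \<Phi>)}"

definition FUND :: "int mat \<Rightarrow> nat vec set" where
  "FUND \<Phi> = {\<beta> \<in> nat_kernel \<Phi>. \<beta> \<noteq> 0\<^sub>v (dim_col \<Phi>) \<and>
     (\<forall>\<gamma>\<in>nat_kernel \<Phi>. \<forall>\<delta>\<in>nat_kernel \<Phi>. \<beta> = \<gamma> + \<delta> \<longrightarrow> \<gamma> = \<beta> \<or> \<delta> = \<beta>)}"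

definition positive_vec :: "nat vec \<Rightarrow> bool" where
  "positive_vec \<beta> \<longleftrightarrow> (\<forall>i<dim_vec \<beta>. 0 < \<beta> $ i)"

text \<open>Subtraction on \<^typ>\<open>nat\<close> truncates, so \<open>\<beta> - \<gamma> \<ge> 0\<close> is written as \<open>\<gamma> \<le> \<beta>\<close>; the
  library order on vectors is coordinatewise.\<close>

definition minimal_positive :: "int mat \<Rightarrow> nat vec set" where
  "minimal_positive \<Phi> = {\<beta> \<in> nat_kernel \<Phi>. positive_vec \<beta> \<and>
     \<not> (\<exists>\<gamma>\<in>nat_kernel \<Phi>. positive_vec \<gamma> \<and> \<gamma> \<noteq> \<beta> \<and> \<gamma> \<le> \<beta>)}"

section \<open>Non-degenerate pairs\<close>

text \<open>Vector indices start at 0, so \<open>a\<^sub>1, \<dots>, a\<^sub>n\<close> are stored at positions \<open>0, \<dots>, n - 1\<close>.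
  The functions below use the indices \<open>0, \<dots>, n + 1\<close> of the mathematical text, including the
  boundary values \<open>a\<^sub>0 = 1\<close>, \<open>b\<^sub>0 = 0\<close>, \<open>a\<^bsub>n+1\<^esub> = 0\<close>, \<open>b\<^bsub>n+1\<^esub> = 1\<close>.\<close>

definition a_ext :: "nat \<Rightarrow> nat vec \<Rightarrow> nat \<Rightarrow> nat" where
  "a_ext n a i = (if i = 0 then 1 else if i = n + 1 then 0 else a $ (i - 1))"

definition b_ext :: "nat \<Rightarrow> nat vec \<Rightarrow> nat \<Rightarrow> nat" where
  "b_ext n b i = (if i = 0 then 0 else if i = n + 1 then 1 else b $ (i - 1))"

definition slope :: "nat \<Rightarrow> nat \<Rightarrow> ereal" where
  "slope x y = (if y = 0 then \<infinity> else ereal (real x / real y))"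

definition non_degenerate :: "nat \<Rightarrow> nat vec \<Rightarrow> nat vec \<Rightarrow> bool" where
  "non_degenerate n a b \<longleftrightarrow>
     (\<forall>i\<le>n. slope (a_ext n a i) (b_ext n b i) > slope (a_ext n a (i + 1)) (b_ext n b (i + 1)))"

section \<open>The matrix and its semigroup of solutions\<close>

text \<open>Coordinates are ordered as \<open>(r, s, h\<^sub>1, k\<^sub>1, m\<^sub>1, \<dots>, h\<^sub>n, k\<^sub>n, m\<^sub>n)\<close>, so for \<open>1 \<le> j \<le> n\<close> the
  entries \<open>h\<^sub>j, k\<^sub>j, m\<^sub>j\<close> sit at positions \<open>3j - 1, 3j, 3j + 1\<close>. Rows \<open>2(j - 1)\<close> and
  \<open>2(j - 1) + 1\<close> express \<open>a\<^sub>j r + h\<^sub>j - m\<^sub>j = 0\<close> and \<open>b\<^sub>j s + k\<^sub>j - m\<^sub>j = 0\<close>.\<close>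

definition Phi :: "nat \<Rightarrow> nat vec \<Rightarrow> nat vec \<Rightarrow> int mat" where
  "Phi n a b = mat (2 * n) (3 * n + 2) (\<lambda>(i, c). let j = i div 2 + 1 in
     if even i
     then (if c = 0 then int (a $ (j - 1)) else if c = 3 * j - 1 then 1
           else if c = 3 * j + 1 then - 1 else 0)
     else (if c = 1 then int (b $ (j - 1)) else if c = 3 * j then 1
           else if c = 3 * j + 1 then - 1 else 0))"

definition proj :: "nat \<Rightarrow> nat vec \<Rightarrow> nat \<times> nat \<times> nat \<times> nat \<times> nat" where
  "proj j \<beta> = (\<beta> $ 0, \<beta> $ 1, \<beta> $ (3 * j - 1), \<beta> $ (3 * j), \<beta> $ (3 * j + 1))"

text \<open>The vector \<open>(r, s, h 1, k 1, m 1, \<dots>, h n, k n, m n)\<close>.\<close>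

definition coord_vec ::
  "nat \<Rightarrow> nat \<Rightarrow> nat \<Rightarrow> (nat \<Rightarrow> nat) \<Rightarrow> (nat \<Rightarrow> nat) \<Rightarrow> (nat \<Rightarrow> nat) \<Rightarrow> nat vec" where
  "coord_vec n r s h k m = vec (3 * n + 2) (\<lambda>c.
     if c = 0 then r else if c = 1 then s
     else let j = (c - 2) div 3 + 1 in
       if c = 3 * j - 1 then h j else if c = 3 * j then k j else m j)"

definition alpha :: "nat \<Rightarrow> nat \<Rightarrow> nat vec" where
  "alpha n i = coord_vec n 0 0
     (\<lambda>j. if j = i then 1 else 0) (\<lambda>j. if j = i then 1 else 0) (\<lambda>j. if j = i then 1 else 0)"

definition beta :: "nat \<Rightarrow> nat vec \<Rightarrow> nat vec \<Rightarrow> nat \<Rightarrow> nat \<Rightarrow> nat vec" where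
  "beta n a b r s = (let M = (\<lambda>j. max (a $ (j - 1) * r) (b $ (j - 1) * s)) in
     coord_vec n r s (\<lambda>j. M j - a $ (j - 1) * r) (\<lambda>j. M j - b $ (j - 1) * s) M)"

text \<open>The vector \<open>(0, 0, 1, \<dots>, 1)\<close>.\<close>

definition shift_vec :: "nat \<Rightarrow> nat vec" where
  "shift_vec n = coord_vec n 0 0 (\<lambda>_. 1) (\<lambda>_. 1) (\<lambda>_. 1)"

definition C_set :: "nat \<Rightarrow> nat vec \<Rightarrow> nat vec \<Rightarrow> nat vec set" where
  "C_set n a b = {\<gamma> + shift_vec n | \<gamma>.
     \<gamma> \<in> FUND (Phi n a b) - (alpha n ` {1..n} \<union> {beta n a b 1 0, beta n a b 0 1})}"

section \<open>Agreement with the coordinate descriptions\<close>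

lemma dim_Phi [simp]: "dim_row (Phi n a b) = 2 * n" "dim_col (Phi n a b) = 3 * n + 2"
  by (simp_all add: Phi_def)

lemma dim_coord_vec [simp]: "dim_vec (coord_vec n r s h k m) = 3 * n + 2"
  by (simp add: coord_vec_def)

lemma coord_vec_index:
  assumes "j \<in> {1..n}"
  shows "coord_vec n r s h k m $ (3 * j - 1) = h j"
    and "coord_vec n r s h k m $ (3 * j) = k j"
    and "coord_vec n r s h k m $ (3 * j + 1) = m j"
proof -
  from assms obtain i where j: "j = Suc i" and i: "i < n"
    by (cases j) auto
  have d: "(3 * i + 1) div 3 = i" "(3 * i + 2) div 3 = i" by presburger+
  show "coord_vec n r s h k m $ (3 * j - 1) = h j"
    using i by (simp add: coord_vec_def j Let_def)
  show "coord_vec n r s h k m $ (3 * j) = k j"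
    using i d by (simp add: coord_vec_def j Let_def)
  show "coord_vec n r s h k m $ (3 * j + 1) = m j"
    using i d by (simp add: coord_vec_def j Let_def)
qed

lemma coord_vec_0_1:
  "coord_vec n r s h k m $ 0 = r" "coord_vec n r s h k m $ Suc 0 = s"
  by (simp_all add: coord_vec_def)

lemma proj_coord_vec:
  assumes "j \<in> {1..n}"
  shows "proj j (coord_vec n r s h k m) = (r, s, h j, k j, m j)"
  using coord_vec_index[OF assms] by (simp add: proj_def coord_vec_0_1)

lemma proj_alpha:
  assumes "j \<in> {1..n}"
  shows "proj j (alpha n i) = (if j = i then (0, 0, 1, 1, 1) else (0, 0, 0, 0, 0))"
  using assms by (simp add: alpha_def proj_coord_vec)

lemma proj_beta:
  assumes "j \<in> {1..n}"
  shows "proj j (beta n a b r s) =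
    (r, s, max (a $ (j - 1) * r) (b $ (j - 1) * s) - a $ (j - 1) * r,
     max (a $ (j - 1) * r) (b $ (j - 1) * s) - b $ (j - 1) * s,
     max (a $ (j - 1) * r) (b $ (j - 1) * s))"
  using assms by (simp add: beta_def Let_def proj_coord_vec)

lemma shift_vec_index:
  assumes "c < 3 * n + 2"
  shows "shift_vec n $ c = (if c < 2 then 0 else 1)"
  using assms by (auto simp: shift_vec_def coord_vec_def Let_def)

lemma sum_three_terms:
  fixes f :: "nat \<Rightarrow> int"
  assumes "distinct [p, q, t]" "p < N" "q < N" "t < N"
    and "\<And>c. c < N \<Longrightarrow> c \<notin> {p, q, t} \<Longrightarrow> f c = 0"
  shows "sum f {0..<N} = f p + f q + f t"
proof -
  have "sum f {0..<N} = sum f {p, q, t}"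
    using assms by (intro sum.mono_neutral_right) auto
  then show ?thesis using assms by simp
qed

lemma Phi_mult_vec_index:
  assumes \<beta>: "\<beta> \<in> carrier_vec (3 * n + 2)" and j: "j \<in> {1..n}"
  shows "(Phi n a b *\<^sub>v map_vec int \<beta>) $ (2 * (j - 1)) =
      int (a $ (j - 1)) * int (\<beta> $ 0) + int (\<beta> $ (3 * j - 1)) - int (\<beta> $ (3 * j + 1))"
    and "(Phi n a b *\<^sub>v map_vec int \<beta>) $ (2 * (j - 1) + 1) =
      int (b $ (j - 1)) * int (\<beta> $ 1) + int (\<beta> $ (3 * j)) - int (\<beta> $ (3 * j + 1))"
proof -
  let ?N = "3 * n + 2"
  from j obtain i where ji: "j = Suc i" and i: "i < n"
    by (cases j) auto
  have e: "3 * j - 1 = 3 * i + 2" "3 * j = 3 * i + 3" "3 * j + 1 = 3 * i + 4" "j - 1 = i"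
    using ji by simp_all
  have P:
    "Phi n a b $$ (2 * i, 0) = int (a $ i)" "Phi n a b $$ (2 * i, 3 * i + 2) = 1"
    "Phi n a b $$ (2 * i, 3 * i + 4) = - 1" "Phi n a b $$ (2 * i + 1, 1) = int (b $ i)"
    "Phi n a b $$ (2 * i + 1, 3 * i + 3) = 1" "Phi n a b $$ (2 * i + 1, 3 * i + 4) = - 1"
    using i by (simp_all add: Phi_def Let_def)
  have d: "dim_vec \<beta> = ?N" using \<beta> by simp
  have "(Phi n a b *\<^sub>v map_vec int \<beta>) $ (2 * i) =
      (\<Sum>c = 0..<?N. Phi n a b $$ (2 * i, c) * int (\<beta> $ c))"
    using i d by (simp add: scalar_prod_def)
  also have "\<dots> = Phi n a b $$ (2 * i, 0) * int (\<beta> $ 0)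
      + Phi n a b $$ (2 * i, 3 * i + 2) * int (\<beta> $ (3 * i + 2))
      + Phi n a b $$ (2 * i, 3 * i + 4) * int (\<beta> $ (3 * i + 4))"
    using i by (intro sum_three_terms) (auto simp: Phi_def Let_def)
  finally show "(Phi n a b *\<^sub>v map_vec int \<beta>) $ (2 * (j - 1)) =
      int (a $ (j - 1)) * int (\<beta> $ 0) + int (\<beta> $ (3 * j - 1)) - int (\<beta> $ (3 * j + 1))"
    unfolding e(1,3) unfolding e(2,4) P by linarith
  have "(Phi n a b *\<^sub>v map_vec int \<beta>) $ (2 * i + 1) =
      (\<Sum>c = 0..<?N. Phi n a b $$ (2 * i + 1, c) * int (\<beta> $ c))"
    using i d by (simp add: scalar_prod_def)
  also have "\<dots> = Phi n a b $$ (2 * i + 1, 1) * int (\<beta> $ 1)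
      + Phi n a b $$ (2 * i + 1, 3 * i + 3) * int (\<beta> $ (3 * i + 3))
      + Phi n a b $$ (2 * i + 1, 3 * i + 4) * int (\<beta> $ (3 * i + 4))"
    using i by (intro sum_three_terms) (auto simp: Phi_def Let_def)
  finally show "(Phi n a b *\<^sub>v map_vec int \<beta>) $ (2 * (j - 1) + 1) =
      int (b $ (j - 1)) * int (\<beta> $ 1) + int (\<beta> $ (3 * j)) - int (\<beta> $ (3 * j + 1))"
    unfolding e(1,3) unfolding e(2,4) P by linarith
qed

lemma nat_kernel_Phi_iff:
  "\<beta> \<in> nat_kernel (Phi n a b) \<longleftrightarrow> \<beta> \<in> carrier_vec (3 * n + 2) \<and>
     (\<forall>j\<in>{1..n}. case proj j \<beta> of (r, s, h, k, m) \<Rightarrow>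
        a $ (j - 1) * r + h = m \<and> m = b $ (j - 1) * s + k)"
  (is "_ \<longleftrightarrow> _ \<and> ?R")
proof (cases "\<beta> \<in> carrier_vec (3 * n + 2)")
  case True
  let ?v = "Phi n a b *\<^sub>v map_vec int \<beta>"
  have "?v = 0\<^sub>v (2 * n) \<longleftrightarrow> (\<forall>i<2 * n. ?v $ i = 0)"
    by (auto simp: vec_eq_iff simp del: index_mult_mat_vec)
  also have "\<dots> \<longleftrightarrow> (\<forall>j\<in>{1..n}. ?v $ (2 * (j - 1)) = 0 \<and> ?v $ (2 * (j - 1) + 1) = 0)"
  proof (intro iffI allI ballI impI conjI)
    fix i assume *: "\<forall>j\<in>{1..n}. ?v $ (2 * (j - 1)) = 0 \<and> ?v $ (2 * (j - 1) + 1) = 0"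
      and i: "i < 2 * n"
    have "i div 2 + 1 \<in> {1..n}" using i by auto
    from bspec[OF * this] have z: "?v $ (2 * (i div 2)) = 0" "?v $ (2 * (i div 2) + 1) = 0"
      by (simp_all del: index_mult_mat_vec)
    show "?v $ i = 0"
    proof (cases "even i")
      case True
      then have "i = 2 * (i div 2)" by simp
      then show ?thesis using z(1) by metis
    next
      case False
      then have "i = 2 * (i div 2) + 1" by presburger
      then show ?thesis using z(2) by metis
    qed
  next
    fix j assume *: "\<forall>i<2 * n. ?v $ i = 0" and j: "j \<in> {1..n}"
    show "?v $ (2 * (j - 1)) = 0" using * j by (intro *[rule_format]) auto
    show "?v $ (2 * (j - 1) + 1) = 0" using * j by (intro *[rule_format]) auto
  qed
  also have "\<dots> \<longleftrightarrow> ?R"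
  proof (intro ball_cong refl)
    fix j assume j: "j \<in> {1..n}"
    have e: "int x * int y + int z - int w = 0 \<longleftrightarrow> x * y + z = w" for x y z w
      by (simp flip: of_nat_mult of_nat_add)
    show "(?v $ (2 * (j - 1)) = 0 \<and> ?v $ (2 * (j - 1) + 1) = 0) \<longleftrightarrow>
      (case proj j \<beta> of (r, s, h, k, m) \<Rightarrow>
        a $ (j - 1) * r + h = m \<and> m = b $ (j - 1) * s + k)"
      unfolding Phi_mult_vec_index[OF True j] e proj_def by auto
  qed
  finally show ?thesis using True by (simp add: nat_kernel_def)
qed (simp add: nat_kernel_def)

end

theory Submission
  imports Defs
begin

text \<open>
  Call a solution \<open>x\<close> of \<open>\<Phi> x = 0\<close> tight if \<open>h\<^sub>j\<close> and \<open>k\<^sub>j\<close> never are both positive. The tight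
  solutions are exactly the vectors \<open>\<beta>(r, s)\<close>, since \<open>a\<^sub>j r + h\<^sub>j = m\<^sub>j = b\<^sub>j s + k\<^sub>j\<close> then forces
  \<open>m\<^sub>j = max (a\<^sub>j r) (b\<^sub>j s)\<close>. They account for both sides of the theorem, because
  \<^item> a fundamental solution is some \<open>\<alpha>\<^sub>j\<close> or tight, as \<open>\<alpha>\<^sub>j\<close> can be split off whenever \<open>h\<^sub>j, k\<^sub>j > 0\<close>
    (\<open>FUND_alpha_or_tight\<close>);
  \<^item> a positive solution with leading coordinates \<open>(r, s)\<close> has \<open>m\<^sub>j \<ge> max (a\<^sub>j r) (b\<^sub>j s) + 1\<close>, so it
    dominates \<open>\<beta>(r, s) + (0, 0, 1, \<dots>, 1)\<close> (\<open>beta_plus_shift_le_positive\<close>), and a minimal one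
    equals that vector.

  It remains to compare, for \<open>r, s > 0\<close>, fundamentality of \<open>\<beta>(r, s)\<close> with minimality of its
  translate. A positive solution below the translate gives a smaller \<open>\<beta>(r', s') \<le> \<beta>(r, s)\<close>, and the
  difference of comparable solutions is a solution, so \<open>\<beta>(r, s)\<close> decomposes. Conversely, if
  \<open>\<beta>(r, s) = \<gamma> + \<delta>\<close> and one summand has positive leading coordinates, then its translate is a
  smaller positive solution. The one decomposition escaping this argument
  separates \<open>r\<close> from \<open>s\<close>, as in \<open>\<beta>(r, s) = \<beta>(r, 0) + \<beta>(0, s)\<close>. It gives \<open>k\<^sub>j \<ge> a\<^sub>j r\<close> and \<open>h\<^sub>j \<ge> b\<^sub>j s\<close>, and
  contradicts tightness as soon as \<open>a\<^sub>j\<close> and \<open>b\<^sub>j\<close> are both positive for some \<open>j\<close>. Non-degeneracy provides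
  this for \<open>j = 1\<close>, because \<open>\<infinity> > a\<^sub>1 / b\<^sub>1 > a\<^sub>2 / b\<^sub>2 \<ge> 0\<close>.

  Finally \<open>\<beta>(r, 0) = r \<beta>(1, 0)\<close> and \<open>\<beta>(0, s) = s \<beta>(0, 1)\<close>, so \<open>\<beta>(1, 0)\<close> and \<open>\<beta>(0, 1)\<close> are the only
  tight vectors with a vanishing leading coordinate that can be fundamental.
\<close>

section \<open>Coordinates\<close>

text \<open>From here on the triples are indexed by \<open>j < n\<close>, the coordinates \<open>h, k, m\<close> of triple \<open>j\<close>
  sitting at \<open>3j + 2, 3j + 3, 3j + 4\<close>, which avoids truncated subtraction.\<close>

text \<open>Simplification would replace \<open>1\<close> and \<open>3 * j + 2\<close> by \<open>Suc\<close> terms, and the equations for the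
  coordinates at these positions would no longer match.\<close>

declare One_nat_def [simp del] add_2_eq_Suc' [simp del]

lemma coordinate_cases:
  fixes c n :: nat
  assumes "c < 3 * n + 2"
  obtains "c = 0" | "c = 1" | j where "j < n" "c = 3 * j + 2" | j where "j < n" "c = 3 * j + 3"
    | j where "j < n" "c = 3 * j + 4"
proof -
  define j where "j = (c - 2) div 3"
  have "c = 0 \<or> c = 1 \<or> (j < n \<and> (c = 3 * j + 2 \<or> c = 3 * j + 3 \<or> c = 3 * j + 4))"
    unfolding j_def using assms by presburger
  then show thesis using that by blast
qed

lemma all_coordinates_iff:
  fixes n :: nat
  shows "(\<forall>c < 3 * n + 2. P c) \<longleftrightarrow>
    P 0 \<and> P 1 \<and> (\<forall>j < n. P (3 * j + 2) \<and> P (3 * j + 3) \<and> P (3 * j + 4))"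
  by (auto elim!: coordinate_cases)

lemma coord_vec_nth:
  assumes "j < n"
  shows "coord_vec n r s h k m $ (3 * j + 2) = h (Suc j)"
    and "coord_vec n r s h k m $ (3 * j + 3) = k (Suc j)"
    and "coord_vec n r s h k m $ (3 * j + 4) = m (Suc j)"
proof -
  have e: "3 * Suc j - 1 = 3 * j + 2" "3 * Suc j + 1 = 3 * j + 4" "3 * Suc j = 3 * j + 3"
    by simp_all
  have "Suc j \<in> {1..n}" using assms by simp
  from coord_vec_index[OF this, unfolded e(1,2), unfolded e(3)]
  show "coord_vec n r s h k m $ (3 * j + 2) = h (Suc j)"
    and "coord_vec n r s h k m $ (3 * j + 3) = k (Suc j)"
    and "coord_vec n r s h k m $ (3 * j + 4) = m (Suc j)" .
qed

lemma alpha_nth: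
  "alpha n i $ 0 = 0" "alpha n i $ 1 = 0"
  "j < n \<Longrightarrow> alpha n i $ (3 * j + 2) = (if Suc j = i then 1 else 0)"
  "j < n \<Longrightarrow> alpha n i $ (3 * j + 3) = (if Suc j = i then 1 else 0)"
  "j < n \<Longrightarrow> alpha n i $ (3 * j + 4) = (if Suc j = i then 1 else 0)"
  by (simp_all only: alpha_def coord_vec_nth coord_vec_0_1 One_nat_def)

lemma shift_vec_nth:
  "shift_vec n $ 0 = 0" "shift_vec n $ 1 = 0"
  "j < n \<Longrightarrow> shift_vec n $ (3 * j + 2) = 1"
  "j < n \<Longrightarrow> shift_vec n $ (3 * j + 3) = 1"
  "j < n \<Longrightarrow> shift_vec n $ (3 * j + 4) = 1"
  by (simp_all only: shift_vec_def coord_vec_nth coord_vec_0_1 One_nat_def)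

lemma beta_nth:
  "beta n a b r s $ 0 = r" "beta n a b r s $ 1 = s"
  "j < n \<Longrightarrow> beta n a b r s $ (3 * j + 2) = max (a $ j * r) (b $ j * s) - a $ j * r"
  "j < n \<Longrightarrow> beta n a b r s $ (3 * j + 3) = max (a $ j * r) (b $ j * s) - b $ j * s"
  "j < n \<Longrightarrow> beta n a b r s $ (3 * j + 4) = max (a $ j * r) (b $ j * s)"
  by (simp_all only: beta_def Let_def coord_vec_nth coord_vec_0_1 One_nat_def diff_Suc_Suc diff_0_eq_0 diff_zero)

lemma dim_solution_vecs [simp]:
  "dim_vec (alpha n i) = 3 * n + 2" "dim_vec (beta n a b r s) = 3 * n + 2"
  "dim_vec (shift_vec n) = 3 * n + 2"
  by (simp_all add: alpha_def beta_def shift_vec_def Let_def)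

section \<open>The semigroup of solutions\<close>

lemma nat_kernel_Phi_nth_iff:
  "x \<in> nat_kernel (Phi n a b) \<longleftrightarrow> dim_vec x = 3 * n + 2 \<and>
     (\<forall>j < n. a $ j * x $ 0 + x $ (3 * j + 2) = x $ (3 * j + 4) \<and>
       b $ j * x $ 1 + x $ (3 * j + 3) = x $ (3 * j + 4))"
proof -
  have reindex: "(\<forall>j\<in>{1..n}. P j) \<longleftrightarrow> (\<forall>j < n. P (Suc j))" for P
    by (simp add: Ball_def Suc_le_eq One_nat_def) (metis Suc_le_eq gr0_conv_Suc zero_less_Suc)
  have e: "3 * Suc j - 1 = 3 * j + 2" "3 * Suc j + 1 = 3 * j + 4" "3 * Suc j = 3 * j + 3" for j
    by simp_all
  show ?thesis
    unfolding nat_kernel_Phi_iff reindex proj_def prod.case e(1,2) diff_Suc_1 carrier_vec_def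
    unfolding e(3) by auto
qed

lemma nat_kernel_Phi_add:
  assumes "x \<in> nat_kernel (Phi n a b)" "y \<in> nat_kernel (Phi n a b)"
  shows "x + y \<in> nat_kernel (Phi n a b)"
  using assms unfolding nat_kernel_Phi_nth_iff by (auto simp: algebra_simps)

lemma nat_kernel_Phi_diff:
  assumes x: "x \<in> nat_kernel (Phi n a b)" and y: "y \<in> nat_kernel (Phi n a b)" and le: "y \<le> x"
  shows "x - y \<in> nat_kernel (Phi n a b)" "x = y + (x - y)"
proof -
  have dx: "dim_vec x = 3 * n + 2" and dy: "dim_vec y = 3 * n + 2"
    using x y by (auto simp: nat_kernel_Phi_nth_iff)
  have le_nth: "y $ c \<le> x $ c" if "c < 3 * n + 2" for c
    using le that dx by (auto simp: less_eq_vec_def)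
  show eq: "x = y + (x - y)"
    using dx dy le_nth by (intro eq_vecI) auto
  have "a $ j * (x - y) $ 0 + (x - y) $ (3 * j + 2) = (x - y) $ (3 * j + 4) \<and>
      b $ j * (x - y) $ 1 + (x - y) $ (3 * j + 3) = (x - y) $ (3 * j + 4)" if "j < n" for j
  proof -
    define z where "z = x - y"
    have split: "x $ c = y $ c + z $ c" if "c < 3 * n + 2" for c
      using le_nth[OF that] dx dy that by (simp add: z_def)
    have sx: "a $ j * x $ 0 + x $ (3 * j + 2) = x $ (3 * j + 4)"
        "b $ j * x $ 1 + x $ (3 * j + 3) = x $ (3 * j + 4)"
      and sy: "a $ j * y $ 0 + y $ (3 * j + 2) = y $ (3 * j + 4)"
        "b $ j * y $ 1 + y $ (3 * j + 3) = y $ (3 * j + 4)"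
      using x y \<open>j < n\<close> by (auto simp: nat_kernel_Phi_nth_iff)
    have s0: "x $ 0 = y $ 0 + z $ 0" and s1: "x $ 1 = y $ 1 + z $ 1"
      and s2: "x $ (3 * j + 2) = y $ (3 * j + 2) + z $ (3 * j + 2)"
      and s3: "x $ (3 * j + 3) = y $ (3 * j + 3) + z $ (3 * j + 3)"
      and s4: "x $ (3 * j + 4) = y $ (3 * j + 4) + z $ (3 * j + 4)"
      using \<open>j < n\<close> by (auto intro!: split)
    have "a $ j * z $ 0 + z $ (3 * j + 2) = z $ (3 * j + 4)"
      using sx(1) sy(1) unfolding s0 s2 s4 distrib_left by linarith
    moreover have "b $ j * z $ 1 + z $ (3 * j + 3) = z $ (3 * j + 4)"
      using sx(2) sy(2) unfolding s1 s3 s4 distrib_left by linarith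
    ultimately show ?thesis by (simp add: z_def)
  qed
  moreover have "dim_vec (x - y) = 3 * n + 2" using dy by simp
  ultimately show "x - y \<in> nat_kernel (Phi n a b)"
    unfolding nat_kernel_Phi_nth_iff by blast
qed

lemma beta_in_nat_kernel: "beta n a b r s \<in> nat_kernel (Phi n a b)"
  unfolding nat_kernel_Phi_nth_iff by (simp add: beta_nth)

lemma alpha_in_nat_kernel: "alpha n i \<in> nat_kernel (Phi n a b)"
  unfolding nat_kernel_Phi_nth_iff by (simp add: alpha_nth)

lemma shift_vec_in_nat_kernel: "shift_vec n \<in> nat_kernel (Phi n a b)"
  unfolding nat_kernel_Phi_nth_iff by (simp add: shift_vec_nth)

text \<open>The tight solutions: where \<open>h\<^sub>j = 0\<close> or \<open>k\<^sub>j = 0\<close>, the coordinate \<open>m\<^sub>j\<close> attains its lower bound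
  \<open>max (a\<^sub>j r) (b\<^sub>j s)\<close>, so the whole vector is determined by \<open>r\<close> and \<open>s\<close>.\<close>

lemma tight_solution_eq_beta:
  assumes x: "x \<in> nat_kernel (Phi n a b)"
    and tight: "\<And>j. j < n \<Longrightarrow> x $ (3 * j + 2) = 0 \<or> x $ (3 * j + 3) = 0"
  shows "x = beta n a b (x $ 0) (x $ 1)"
proof (rule eq_vecI)
  show "dim_vec x = dim_vec (beta n a b (x $ 0) (x $ 1))"
    using x by (simp add: nat_kernel_Phi_nth_iff)
  have "\<forall>c < 3 * n + 2. x $ c = beta n a b (x $ 0) (x $ 1) $ c"
    unfolding all_coordinates_iff
  proof (intro conjI allI impI)
    fix j assume j: "j < n"
    have eqs: "a $ j * x $ 0 + x $ (3 * j + 2) = x $ (3 * j + 4)"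
        "b $ j * x $ 1 + x $ (3 * j + 3) = x $ (3 * j + 4)"
      using x j by (auto simp: nat_kernel_Phi_nth_iff)
    then show "x $ (3 * j + 2) = beta n a b (x $ 0) (x $ 1) $ (3 * j + 2)"
        "x $ (3 * j + 3) = beta n a b (x $ 0) (x $ 1) $ (3 * j + 3)"
        "x $ (3 * j + 4) = beta n a b (x $ 0) (x $ 1) $ (3 * j + 4)"
      using tight[OF j] unfolding beta_nth(3-5)[OF j] by linarith+
  qed (simp_all only: beta_nth)
  then show "x $ c = beta n a b (x $ 0) (x $ 1) $ c"
    if "c < dim_vec (beta n a b (x $ 0) (x $ 1))" for c
    using that unfolding dim_solution_vecs by blast
qed

lemma beta_tight:
  assumes "j < n"
  shows "beta n a b r s $ (3 * j + 2) = 0 \<or> beta n a b r s $ (3 * j + 3) = 0"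
  unfolding beta_nth(3,4)[OF assms] by linarith

section \<open>Fundamental solutions\<close>

lemma FUND_D:
  assumes "x \<in> FUND (Phi n a b)"
  shows "x \<in> nat_kernel (Phi n a b)" "x \<noteq> 0\<^sub>v (3 * n + 2)"
    and "y \<in> nat_kernel (Phi n a b) \<Longrightarrow> z \<in> nat_kernel (Phi n a b) \<Longrightarrow> x = y + z \<Longrightarrow> y = x \<or> z = x"
  using assms by (auto simp: FUND_def)

text \<open>Since \<open>x = y + (x - y)\<close> is a decomposition into solutions, \<open>y = x\<close> or \<open>x - y = x\<close>. The latter
  means \<open>y = 0\<close>, which one positive coordinate excludes.\<close>

lemma FUND_solution_below:
  assumes x: "x \<in> FUND (Phi n a b)" and y: "y \<in> nat_kernel (Phi n a b)" and le: "y \<le> x"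
    and c: "c < 3 * n + 2" "y $ c > 0"
  shows "y = x"
proof -
  have ker: "x \<in> nat_kernel (Phi n a b)" using FUND_D(1)[OF x] .
  have dims: "dim_vec x = 3 * n + 2" "dim_vec y = 3 * n + 2"
    using ker y by (auto simp: nat_kernel_Phi_nth_iff)
  have "y = x \<or> x - y = x"
    using FUND_D(3)[OF x y nat_kernel_Phi_diff[OF ker y le]] .
  moreover have "x - y \<noteq> x"
  proof
    assume "x - y = x"
    then have "x $ c - y $ c = x $ c" using c dims by (metis index_minus_vec(1))
    moreover have "y $ c \<le> x $ c" using le c dims by (auto simp: less_eq_vec_def)
    ultimately show False using c by linarith
  qed
  ultimately show ?thesis by blast
qed

text \<open>If \<open>h\<^sub>j, k\<^sub>j > 0\<close>, then \<open>m\<^sub>j > 0\<close> as well, and \<open>\<alpha>\<^sub>j\<close> lies below \<open>x\<close>.\<close>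

lemma FUND_alpha_or_tight:
  assumes x: "x \<in> FUND (Phi n a b)"
  shows "x \<in> alpha n ` {1..n} \<or> x = beta n a b (x $ 0) (x $ 1)"
proof (cases "\<exists>j<n. x $ (3 * j + 2) > 0 \<and> x $ (3 * j + 3) > 0")
  case True
  then obtain j where j: "j < n" and pos: "x $ (3 * j + 2) > 0" "x $ (3 * j + 3) > 0" by blast
  have ker: "x \<in> nat_kernel (Phi n a b)" using FUND_D(1)[OF x] .
  then have m: "x $ (3 * j + 4) > 0"
    using j pos unfolding nat_kernel_Phi_nth_iff by (metis add_gr_0)
  have "\<forall>c < 3 * n + 2. alpha n (Suc j) $ c \<le> x $ c"
    unfolding all_coordinates_iff using pos m
    by (auto simp: alpha_nth Suc_le_eq)
  then have "alpha n (Suc j) \<le> x"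
    using ker by (simp add: less_eq_vec_def nat_kernel_Phi_nth_iff)
  then have "alpha n (Suc j) = x"
    using j by (intro FUND_solution_below[OF x alpha_in_nat_kernel, where c = "3 * j + 2"])
      (simp_all add: alpha_nth)
  then show ?thesis using j by force
next
  case False
  then have "x = beta n a b (x $ 0) (x $ 1)"
    by (intro tight_solution_eq_beta FUND_D(1)[OF x]) auto
  then show ?thesis ..
qed

text \<open>For \<open>r > 1\<close> the vector \<open>\<beta>(r, 0) = \<beta>(1, 0) + \<beta>(r - 1, 0)\<close> is not fundamental, and \<open>\<beta>(0, 0) = 0\<close> is
  excluded by definition; symmetrically on the other axis.\<close>

lemma FUND_beta_on_axis:
  assumes x: "beta n a b r s \<in> FUND (Phi n a b)" and axis: "r = 0 \<or> s = 0"
  shows "beta n a b r s = beta n a b 1 0 \<or> beta n a b r s = beta n a b 0 1"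
proof -
  have "beta n a b 0 0 = 0\<^sub>v (3 * n + 2)"
  proof (rule eq_vecI)
    have "\<forall>c < 3 * n + 2. beta n a b 0 0 $ c = 0"
      unfolding all_coordinates_iff by (simp add: beta_nth)
    then show "beta n a b 0 0 $ c = 0\<^sub>v (3 * n + 2) $ c" if "c < dim_vec (0\<^sub>v (3 * n + 2))" for c
      using that by simp
  qed simp
  then have nonzero: "r > 0 \<or> s > 0"
    using FUND_D(2)[OF x] by auto
  have le_mult: "c \<le> c * t" if "t > 0" for c t :: nat
    using that by (cases t) auto
  show ?thesis
  proof (cases "s = 0")
    case True
    then have r: "r > 0" using nonzero by simp
    have "\<forall>c < 3 * n + 2. beta n a b 1 0 $ c \<le> beta n a b r s $ c"
      unfolding all_coordinates_iff using True r le_mult[OF r]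
      by (simp add: beta_nth)
    then have "beta n a b 1 0 \<le> beta n a b r s" by (simp add: less_eq_vec_def)
    then have "beta n a b 1 0 = beta n a b r s"
      by (intro FUND_solution_below[OF x beta_in_nat_kernel, where c = 0])
        (simp_all add: beta_nth)
    then show ?thesis by simp
  next
    case False
    then have s: "s > 0" and r: "r = 0" using axis by auto
    have "\<forall>c < 3 * n + 2. beta n a b 0 1 $ c \<le> beta n a b r s $ c"
      unfolding all_coordinates_iff using r s le_mult[OF s]
      by (simp add: beta_nth)
    then have "beta n a b 0 1 \<le> beta n a b r s" by (simp add: less_eq_vec_def)
    then have "beta n a b 0 1 = beta n a b r s"
      by (intro FUND_solution_below[OF x beta_in_nat_kernel, where c = 1])
        (simp_all add: beta_nth)
    then show ?thesis by simp
  qed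
qed

section \<open>Positive solutions\<close>

lemma positive_vec_nth_iff:
  assumes "dim_vec x = 3 * n + 2"
  shows "positive_vec x \<longleftrightarrow> x $ 0 > 0 \<and> x $ 1 > 0 \<and>
    (\<forall>j < n. x $ (3 * j + 2) > 0 \<and> x $ (3 * j + 3) > 0 \<and> x $ (3 * j + 4) > 0)"
  unfolding positive_vec_def assms all_coordinates_iff ..

lemma plus_shift_positive:
  assumes "dim_vec x = 3 * n + 2" "x $ 0 > 0" "x $ 1 > 0"
  shows "positive_vec (x + shift_vec n)"
  using assms by (simp add: positive_vec_nth_iff[where n = n] shift_vec_nth)

text \<open>Positivity of \<open>h\<^sub>j\<close> and \<open>k\<^sub>j\<close> makes \<open>m\<^sub>j\<close> exceed both \<open>a\<^sub>j r\<close> and \<open>b\<^sub>j s\<close>.\<close>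

lemma beta_plus_shift_le_positive:
  assumes x: "x \<in> nat_kernel (Phi n a b)" and pos: "positive_vec x"
  shows "beta n a b (x $ 0) (x $ 1) + shift_vec n \<le> x"
proof -
  have dim: "dim_vec x = 3 * n + 2" using x by (simp add: nat_kernel_Phi_nth_iff)
  have "\<forall>c < 3 * n + 2. beta n a b (x $ 0) (x $ 1) $ c + shift_vec n $ c \<le> x $ c"
    unfolding all_coordinates_iff
  proof (intro conjI allI impI)
    fix j assume j: "j < n"
    have eqs: "a $ j * x $ 0 + x $ (3 * j + 2) = x $ (3 * j + 4)"
        "b $ j * x $ 1 + x $ (3 * j + 3) = x $ (3 * j + 4)"
      using x j by (auto simp: nat_kernel_Phi_nth_iff)
    have "x $ (3 * j + 2) > 0" "x $ (3 * j + 3) > 0"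
      using pos j unfolding positive_vec_nth_iff[OF dim] by auto
    then show
      "beta n a b (x $ 0) (x $ 1) $ (3 * j + 2) + shift_vec n $ (3 * j + 2) \<le> x $ (3 * j + 2)"
      "beta n a b (x $ 0) (x $ 1) $ (3 * j + 3) + shift_vec n $ (3 * j + 3) \<le> x $ (3 * j + 3)"
      "beta n a b (x $ 0) (x $ 1) $ (3 * j + 4) + shift_vec n $ (3 * j + 4) \<le> x $ (3 * j + 4)"
      using eqs unfolding beta_nth(3-5)[OF j] shift_vec_nth(3-5)[OF j] by linarith+
  qed (simp_all only: beta_nth shift_vec_nth)
  then show ?thesis using dim by (simp add: less_eq_vec_def)
qed

lemma minimal_positive_D:
  assumes "x \<in> minimal_positive (Phi n a b)"
  shows "x \<in> nat_kernel (Phi n a b)" "positive_vec x"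
    and "y \<in> nat_kernel (Phi n a b) \<Longrightarrow> positive_vec y \<Longrightarrow> y \<le> x \<Longrightarrow> y = x"
  using assms by (auto simp: minimal_positive_def)

lemma plus_shift_cancel:
  assumes "dim_vec x = 3 * n + 2" "dim_vec y = 3 * n + 2"
  shows "x + shift_vec n \<le> y + shift_vec n \<longleftrightarrow> x \<le> y"
    and "x + shift_vec n = y + shift_vec n \<longleftrightarrow> x = y"
  using assms by (auto simp: less_eq_vec_def vec_eq_iff)

text \<open>With both leading coordinates positive, the translate of the summand \<open>y\<close> is a positive solution below the minimal one.\<close>

lemma minimal_positive_summand:
  assumes min: "x + shift_vec n \<in> minimal_positive (Phi n a b)"
    and y: "y \<in> nat_kernel (Phi n a b)" and z: "z \<in> nat_kernel (Phi n a b)" and x: "x = y + z"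
    and pos: "y $ 0 > 0" "y $ 1 > 0"
  shows "y = x"
proof -
  have dims: "dim_vec y = 3 * n + 2" "dim_vec z = 3 * n + 2"
    using y z by (auto simp: nat_kernel_Phi_nth_iff)
  then have dim: "dim_vec x = 3 * n + 2" by (simp add: x)
  have "y \<le> x" using dims by (simp add: x less_eq_vec_def)
  then have "y + shift_vec n \<le> x + shift_vec n" using plus_shift_cancel(1) dims dim by blast
  then have "y + shift_vec n = x + shift_vec n"
    using minimal_positive_D(3)[OF min nat_kernel_Phi_add[OF y shift_vec_in_nat_kernel]]
      plus_shift_positive[OF dims(1) pos] by blast
  then show ?thesis using plus_shift_cancel(2) dims dim by blast
qed

text \<open>Since \<open>s\<close> is absent from the first summand, \<open>k\<^sub>j = m\<^sub>j \<ge> a\<^sub>j r > 0\<close> there; likewise \<open>h\<^sub>j > 0\<close> in the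
  second. The sum then has \<open>h\<^sub>j, k\<^sub>j > 0\<close>.\<close>

lemma separated_sum_not_tight:
  assumes j: "j < n" "a $ j > 0" "b $ j > 0"
    and y: "y \<in> nat_kernel (Phi n a b)" and z: "z \<in> nat_kernel (Phi n a b)"
    and sep: "y $ 0 > 0" "y $ 1 = 0" "z $ 0 = 0" "z $ 1 > 0"
  shows "(y + z) $ (3 * j + 2) > 0 \<and> (y + z) $ (3 * j + 3) > 0"
proof -
  have "a $ j * y $ 0 + y $ (3 * j + 2) = y $ (3 * j + 4)" "y $ (3 * j + 3) = y $ (3 * j + 4)"
      "z $ (3 * j + 2) = z $ (3 * j + 4)" "b $ j * z $ 1 + z $ (3 * j + 3) = z $ (3 * j + 4)"
    using y z j sep unfolding nat_kernel_Phi_nth_iff by force+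
  moreover have "a $ j * y $ 0 > 0" "b $ j * z $ 1 > 0"
    using j sep by simp_all
  ultimately have "z $ (3 * j + 2) > 0" "y $ (3 * j + 3) > 0" by linarith+
  moreover have "dim_vec z = 3 * n + 2" using z by (simp add: nat_kernel_Phi_nth_iff)
  ultimately show ?thesis using j by simp
qed

text \<open>The bound \<open>a\<^sub>1 / b\<^sub>1 < \<infinity>\<close> comes from comparison with \<open>a\<^sub>0 / b\<^sub>0\<close>, and \<open>a\<^sub>1 / b\<^sub>1 > 0\<close> from comparison
  with the nonnegative \<open>a\<^sub>2 / b\<^sub>2\<close>, which is the boundary value \<open>0 / 1\<close> when \<open>n = 1\<close>.\<close>

lemma non_degenerate_first_positive:
  assumes "n \<ge> 1" "non_degenerate n a b"
  shows "a $ 0 > 0" "b $ 0 > 0"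
proof -
  have "slope (a_ext n a i) (b_ext n b i) > slope (a_ext n a (i + 1)) (b_ext n b (i + 1))"
    if "i \<le> n" for i
    using assms(2) that by (simp add: non_degenerate_def)
  from this[of 0] this[of 1] assms(1)
  have lt: "slope (a $ 0) (b $ 0) < \<infinity>"
    and gt: "slope (a $ 0) (b $ 0) > slope (a_ext n a 2) (b_ext n b 2)"
    by (simp_all add: a_ext_def b_ext_def slope_def numeral_2_eq_2)
  show b: "b $ 0 > 0" using lt by (auto simp: slope_def split: if_splits)
  have "slope (a_ext n a 2) (b_ext n b 2) \<ge> 0" by (simp add: slope_def)
  then have "slope (a $ 0) (b $ 0) > 0" using gt by order
  then show "a $ 0 > 0" using b by (auto simp: slope_def intro: ccontr)
qed

text \<open>In a decomposition either some summand has both leading coordinates positive and exhausts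
  \<open>\<beta>(r, s)\<close> by minimality, or one summand carries all of \<open>r\<close> and the other all of \<open>s\<close>, which tightness
  of \<open>\<beta>(r, s)\<close> forbids.\<close>

lemma minimal_positive_beta_imp_FUND:
  assumes j: "j < n" "a $ j > 0" "b $ j > 0" and rs: "r > 0" "s > 0"
    and min: "beta n a b r s + shift_vec n \<in> minimal_positive (Phi n a b)"
  shows "beta n a b r s \<in> FUND (Phi n a b)"
proof -
  have "y = beta n a b r s \<or> z = beta n a b r s"
    if y: "y \<in> nat_kernel (Phi n a b)" and z: "z \<in> nat_kernel (Phi n a b)"
      and eq: "beta n a b r s = y + z" for y z
  proof -
    have dims: "dim_vec y = 3 * n + 2" "dim_vec z = 3 * n + 2"
      using y z by (auto simp: nat_kernel_Phi_nth_iff)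
    have eq': "beta n a b r s = z + y"
      unfolding eq using dims by (intro comm_add_vec carrier_vecI)
    have "r = y $ 0 + z $ 0" "s = y $ 1 + z $ 1"
      using arg_cong[OF eq, of "\<lambda>v. v $ 0"] arg_cong[OF eq, of "\<lambda>v. v $ 1"] dims
      unfolding beta_nth by simp_all
    then consider "y $ 0 > 0" "y $ 1 > 0" | "z $ 0 > 0" "z $ 1 > 0"
      | "y $ 0 > 0" "y $ 1 = 0" "z $ 0 = 0" "z $ 1 > 0"
      | "z $ 0 > 0" "z $ 1 = 0" "y $ 0 = 0" "y $ 1 > 0"
      using rs by linarith
    then show ?thesis
    proof cases
      case 1
      then show ?thesis using minimal_positive_summand[OF min y z eq] by blast
    next
      case 2
      then show ?thesis using minimal_positive_summand[OF min z y eq'] by blast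
    next
      case 3
      from separated_sum_not_tight[where a = a and b = b, OF j y z this] beta_tight[OF j(1), of a b r s]
      show ?thesis unfolding eq by simp
    next
      case 4
      from separated_sum_not_tight[where a = a and b = b, OF j z y this] beta_tight[OF j(1), of a b r s]
      show ?thesis unfolding eq' by simp
    qed
  qed
  moreover have "beta n a b r s \<noteq> 0\<^sub>v (3 * n + 2)"
  proof
    assume "beta n a b r s = 0\<^sub>v (3 * n + 2)"
    then have "beta n a b r s $ 0 = 0" by simp
    then show False using rs by (simp add: beta_nth)
  qed
  ultimately show ?thesis using beta_in_nat_kernel by (auto simp: FUND_def)
qed

text \<open>A positive solution \<open>y\<close> below the translate of \<open>\<beta>(r, s)\<close> itself lies above the translate of some
  \<open>\<beta>(r', s')\<close>. Then \<open>\<beta>(r', s') \<le> \<beta>(r, s)\<close>, and fundamentality collapses the chain of inequalities.\<close>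

lemma FUND_beta_imp_minimal_positive:
  assumes rs: "r > 0" "s > 0" and fund: "beta n a b r s \<in> FUND (Phi n a b)"
  shows "beta n a b r s + shift_vec n \<in> minimal_positive (Phi n a b)"
proof -
  let ?x = "beta n a b r s"
  have "y = ?x + shift_vec n"
    if y: "y \<in> nat_kernel (Phi n a b)" and pos: "positive_vec y" and le: "y \<le> ?x + shift_vec n"
    for y
  proof -
    let ?z = "beta n a b (y $ 0) (y $ 1)"
    have zy: "?z + shift_vec n \<le> y" using beta_plus_shift_le_positive[OF y pos] .
    then have "?z + shift_vec n \<le> ?x + shift_vec n" using le by order
    then have "?z \<le> ?x" by (simp add: plus_shift_cancel(1))
    moreover have "y $ 0 > 0"
      using y pos unfolding positive_vec_def nat_kernel_Phi_nth_iff by simp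
    ultimately have "?z = ?x"
      by (intro FUND_solution_below[OF fund beta_in_nat_kernel, where c = 0])
        (simp_all add: beta_nth)
    then show ?thesis using zy le by auto
  qed
  moreover have "?x + shift_vec n \<in> nat_kernel (Phi n a b)"
    using nat_kernel_Phi_add[OF beta_in_nat_kernel shift_vec_in_nat_kernel] .
  moreover have "positive_vec (?x + shift_vec n)"
    using rs by (intro plus_shift_positive) (simp_all add: beta_nth)
  ultimately show ?thesis unfolding minimal_positive_def by blast
qed

theorem theorem2p15:
  fixes n :: nat and a b :: "nat vec"
  assumes "n \<ge> 1"
    and "a \<in> carrier_vec n" and "b \<in> carrier_vec n"
    and "non_degenerate n a b"
  shows "minimal_positive (Phi n a b) = C_set n a b"
proof (intro equalityI subsetI)
  fix x assume min: "x \<in> minimal_positive (Phi n a b)"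
  note x = minimal_positive_D(1,2)[OF min]
  have dim: "dim_vec x = 3 * n + 2" using x(1) by (simp add: nat_kernel_Phi_nth_iff)
  have rs: "x $ 0 > 0" "x $ 1 > 0"
    using x(2) unfolding positive_vec_nth_iff[OF dim] by blast+
  let ?y = "beta n a b (x $ 0) (x $ 1)"
  have "?y + shift_vec n = x"
    using rs by (intro minimal_positive_D(3)[OF min] beta_plus_shift_le_positive[OF x]
      nat_kernel_Phi_add beta_in_nat_kernel shift_vec_in_nat_kernel plus_shift_positive)
      (simp_all add: beta_nth)
  moreover from this have "?y \<in> FUND (Phi n a b)"
    using non_degenerate_first_positive[OF assms(1,4)] rs min assms(1)
    by (intro minimal_positive_beta_imp_FUND[of 0]) auto
  \<comment> \<open>Each vector excluded from \<open>C\<close> has a vanishing leading coordinate.\<close>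
  moreover have "?y \<noteq> v" if "v $ 0 = 0 \<or> v $ 1 = 0" for v
  proof
    assume "?y = v"
    then have "x $ 0 = v $ 0" "x $ 1 = v $ 1" by (metis beta_nth(1), metis beta_nth(2))
    then show False using rs that by simp
  qed
  then have "?y \<notin> alpha n ` {1..n} \<union> {beta n a b 1 0, beta n a b 0 1}"
    using alpha_nth(1) beta_nth(1,2) by auto
  ultimately show "x \<in> C_set n a b"
    unfolding C_set_def by (intro CollectI exI[of _ ?y] conjI DiffI) simp_all
next
  fix x assume "x \<in> C_set n a b"
  then obtain y where x: "x = y + shift_vec n" and y: "y \<in> FUND (Phi n a b)"
      "y \<notin> alpha n ` {1..n}" "y \<noteq> beta n a b 1 0" "y \<noteq> beta n a b 0 1"
    unfolding C_set_def by blast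
  then have eq: "y = beta n a b (y $ 0) (y $ 1)" using FUND_alpha_or_tight by blast
  then have fund: "beta n a b (y $ 0) (y $ 1) \<in> FUND (Phi n a b)" using y(1) by simp
  have "y $ 0 > 0" "y $ 1 > 0"
    using FUND_beta_on_axis[OF fund] y(3,4) eq by (metis gr0I)+
  from FUND_beta_imp_minimal_positive[OF this fund]
  show "x \<in> minimal_positive (Phi n a b)" unfolding x using eq by simp
qed

end
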